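(* Let $A\in\mathbb R$, $B>0$, $S>0$, and consider the one-dimensional harmonic oscillator: $P(x,\cdot)=\mathcal N(Ax,B)$, $G(x)=e^{-Sx^2/2}$ on $\mathbb R$, and $\eta_0=\mathcal N(m_0,\sigma_0^2)$ with $\sigma_0^2>0$. Let $\eta_n$ be the associated Feynman–Kac flow and $\eta_n^N$ the occupation measures of the associated $N$-walker Diffusion Monte Carlo method. Assume $A^2>1$. Then for any $p\in\mathbb N^*$ and any number of walkers $N\in\mathbb N^*$, $$\sup_{n\in\mathbb N}\mathbb E\left(|\eta_n(I)-\eta_n^N(I)|^p\right)^{1/p}=+\infty,$$ where $I(x)=x$.
   Context: $\mathbb N=\{0,1,\dots\}$, $\mathbb N^*=\mathbb N\setminus\{0\}$, $\mu(f)=\int f\,d\mu$, $\psi_G(\mu)(dx)=G(x)\mu(dx)/\mu(G)$. The Feynman–Kac flow is $\eta_{n+1}=\psi_G(\eta_n)P$. Diffusion Monte Carlo with $N$ walkers: for each $n$ and probability $\eta$, fix $\epsilon_n(\eta)\in[0,1]$ with $\epsilon_n(\eta)G(x)\in[0,1]$ for $\eta$-a.e. $x$, and set $S_{n,\eta}(x,dy)=\epsilon_n(\eta)G(x)\delta_x(dy)+(1-\epsilon_n(\eta)G(x))\psi_G(\eta)(dy)$, $K_{n+1,\eta}=S_{n,\eta}P$. The walkers $\xi_0^1,\dots,\xi_0^N$ are i.i.d. with law $\eta_0$; given $\xi_n$, the $\xi_{n+1}^i$ are conditionally independent with laws $K_{n+1,\eta_n^N}(\xi_n^i,\cdot)$,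 where $\eta_n^N:=\frac1N\sum_{i=1}^N\delta_{\xi_n^i}$. *)

theory Defs
  imports "HOL-Probability.Probability"
begin

definition fk_update :: "('a \<Rightarrow> real) \<Rightarrow> 'a measure \<Rightarrow> 'a measure" where
  "fk_update G \<mu> = density \<mu> (\<lambda>x. ennreal (G x / (\<integral>y. G y \<partial>\<mu>)))"

primrec fk_flow :: "('a \<Rightarrow> real) \<Rightarrow> ('a \<Rightarrow> 'a measure) \<Rightarrow> 'a measure \<Rightarrow> nat \<Rightarrow> 'a measure" where
  "fk_flow G P \<eta>0 0 = \<eta>0"
| "fk_flow G P \<eta>0 (Suc n) = bind (fk_update G (fk_flow G P \<eta>0 n)) P"

text \<open>The measure $\frac1N\sum_{i<N}\delta_{x_i}$, as the push-forward of the uniform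
  distribution on the indices; see \<open>emeasure_empirical\<close> below.\<close>

definition empirical :: "nat \<Rightarrow> (nat \<Rightarrow> 'a::topological_space) \<Rightarrow> 'a measure" where
  "empirical N x = distr (uniform_count_measure {..<N}) borel x"

lemma emeasure_empirical:
  assumes "N \<ge> 1" "A \<in> sets borel"
  shows "emeasure (empirical N x) A = ennreal ((\<Sum>i<N. indicator A (x i)) / real N)"
proof -
  have [measurable]: "x \<in> measurable (uniform_count_measure {..<N}) borel"
    by (auto simp: measurable_def sets_uniform_count_measure space_uniform_count_measure)
  have "emeasure (empirical N x) A = emeasure (uniform_count_measure {..<N}) (x -` A \<inter> {..<N})"
    using assms by (simp add: empirical_def emeasure_distr space_uniform_count_measure)
  also have "\<dots> = ennreal (card (x -` A \<inter> {..<N}) / real N)"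
    using assms by (subst emeasure_uniform_count_measure) auto
  also have "real (card (x -` A \<inter> {..<N})) = (\<Sum>i<N. indicator A (x i))"
  proof -
    have "(\<Sum>i<N. indicator A (x i) :: real) = (\<Sum>i<N. if i \<in> x -` A then 1 else 0)"
      by (intro sum.cong) (auto simp: indicator_def)
    also have "\<dots> = real (card ({..<N} \<inter> x -` A))"
      by (simp add: sum.If_cases Int_def)
    finally show ?thesis
      by (simp add: Int_commute)
  qed
  finally show ?thesis .
qed

definition admissible_eps ::
    "('a::topological_space \<Rightarrow> real) \<Rightarrow> (nat \<Rightarrow> 'a measure \<Rightarrow> real) \<Rightarrow> bool" where
  "admissible_eps G \<epsilon> \<longleftrightarrow>
     (\<forall>n \<eta>. prob_space \<eta> \<longrightarrow> sets \<eta> = sets borel \<longrightarrow>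
        \<epsilon> n \<eta> \<in> {0..1} \<and> (AE x in \<eta>. \<epsilon> n \<eta> * G x \<in> {0..1}))"

text \<open>The measure $S(x,\cdot) = e\,G(x)\,\delta_x + (1 - e\,G(x))\,\psi_G(\eta)$, where \<open>e\<close> stands
  for the value \<open>\<epsilon> n \<eta>\<close>. It is meaningful at points with \<open>e * G x \<in> {0..1}\<close>.\<close>

definition dmc_selection ::
    "('a::topological_space \<Rightarrow> real) \<Rightarrow> real \<Rightarrow> 'a measure \<Rightarrow> 'a \<Rightarrow> 'a measure" where
  "dmc_selection G e \<eta> x = measure_of UNIV (sets borel)
     (\<lambda>A. ennreal (e * G x) * emeasure (return borel x) A
          + ennreal (1 - e * G x) * emeasure (fk_update G \<eta>) A)"

lemma emeasure_dmc_selection: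
  assumes "sets \<eta> = sets borel" "A \<in> sets borel"
  shows "emeasure (dmc_selection G e \<eta> x) A =
    ennreal (e * G x) * indicator A x + ennreal (1 - e * G x) * emeasure (fk_update G \<eta>) A"
proof -
  have sb: "sets (fk_update G \<eta>) = sets borel"
    using assms(1) by (simp add: fk_update_def)
  have alg: "sigma_algebra UNIV (sets (borel :: 'a measure))"
    using sets.sigma_algebra_axioms[of "borel :: 'a measure"] by simp
  have "emeasure (dmc_selection G e \<eta> x) A =
    ennreal (e * G x) * emeasure (return borel x) A
      + ennreal (1 - e * G x) * emeasure (fk_update G \<eta>) A"
    unfolding dmc_selection_def
  proof (rule emeasure_measure_of_sigma[OF alg])
    show "positive (sets borel) (\<lambda>A. ennreal (e * G x) * emeasure (return borel x) A
          + ennreal (1 - e * G x) * emeasure (fk_update G \<eta>) A)"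
      by (simp add: positive_def)
    show "countably_additive (sets borel) (\<lambda>A. ennreal (e * G x) * emeasure (return borel x) A
          + ennreal (1 - e * G x) * emeasure (fk_update G \<eta>) A)"
    proof (rule countably_additiveI)
      fix F :: "nat \<Rightarrow> 'a set"
      assume F: "range F \<subseteq> sets borel" "disjoint_family F"
      have 1: "(\<Sum>i. emeasure (return borel x) (F i)) = emeasure (return borel x) (\<Union>(range F))"
        using F by (intro suminf_emeasure) auto
      have 2: "(\<Sum>i. emeasure (fk_update G \<eta>) (F i)) = emeasure (fk_update G \<eta>) (\<Union>(range F))"
        using F by (intro suminf_emeasure) (auto simp: sb)
      show "(\<Sum>i. ennreal (e * G x) * emeasure (return borel x) (F i)
            + ennreal (1 - e * G x) * emeasure (fk_update G \<eta>) (F i)) =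
          ennreal (e * G x) * emeasure (return borel x) (\<Union>(range F))
            + ennreal (1 - e * G x) * emeasure (fk_update G \<eta>) (\<Union>(range F))"
        by (simp add: suminf_add[symmetric] ennreal_suminf_cmult 1 2)
    qed
    show "A \<in> sets borel" by (fact assms(2))
  qed
  then show ?thesis
    using assms(2) by simp
qed

definition dmc_kernel ::
    "('a::topological_space \<Rightarrow> real) \<Rightarrow> ('a \<Rightarrow> 'a measure) \<Rightarrow> real \<Rightarrow> 'a measure \<Rightarrow> 'a \<Rightarrow> 'a measure"
  where
  "dmc_kernel G P e \<eta> x = bind (dmc_selection G e \<eta> x) P"

definition walkers_algebra ::
    "'w measure \<Rightarrow> nat \<Rightarrow> (nat \<Rightarrow> 'w \<Rightarrow> 'a::topological_space) \<Rightarrow> 'w measure" where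
  "walkers_algebra M N X =
     vimage_algebra (space M) (\<lambda>\<omega>. \<lambda>i\<in>{..<N}. X i \<omega>) (PiM {..<N} (\<lambda>_. borel))"

text \<open>\<open>\<xi> n i\<close> (with \<open>i < N\<close>) is the \<open>i\<close>-th walker at time \<open>n\<close>. The last clause says that, given
  \<open>\<xi> n\<close>, the walkers \<open>\<xi> (Suc n) i\<close> are conditionally independent with the prescribed laws: the
  conditional probability of a measurable rectangle is the product of the conditional laws of its
  sides (taking \<open>A j = UNIV\<close> for \<open>j \<noteq> i\<close> gives the conditional law of the \<open>i\<close>-th walker).\<close>

definition dmc_walkers ::
    "'w measure \<Rightarrow> nat \<Rightarrow> ('a::topological_space \<Rightarrow> real) \<Rightarrow> ('a \<Rightarrow> 'a measure) \<Rightarrow> 'a measure \<Rightarrow>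
     (nat \<Rightarrow> 'a measure \<Rightarrow> real) \<Rightarrow> (nat \<Rightarrow> nat \<Rightarrow> 'w \<Rightarrow> 'a) \<Rightarrow> bool" where
  "dmc_walkers M N G P \<eta>0 \<epsilon> \<xi> \<longleftrightarrow>
     prob_space M \<and>
     (\<forall>n. \<forall>i<N. \<xi> n i \<in> measurable M borel) \<and>
     prob_space.indep_vars M (\<lambda>_. borel) (\<xi> 0) {..<N} \<and>
     (\<forall>i<N. distr M borel (\<xi> 0 i) = \<eta>0) \<and>
     (\<forall>n. \<forall>A. (\<forall>i<N. A i \<in> sets borel) \<longrightarrow>
        (AE \<omega> in M.
           real_cond_exp M (walkers_algebra M N (\<xi> n))
             (indicator {\<omega>' \<in> space M. \<forall>i<N. \<xi> (Suc n) i \<omega>' \<in> A i}) \<omega> =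
           (let \<eta> = empirical N (\<lambda>i. \<xi> n i \<omega>)
            in \<Prod>i<N. measure (dmc_kernel G P (\<epsilon> n \<eta>) \<eta> (\<xi> n i \<omega>)) (A i))))"

definition Lp_norm :: "'w measure \<Rightarrow> nat \<Rightarrow> ('w \<Rightarrow> real) \<Rightarrow> ennreal" where
  "Lp_norm M p X =
     (let E = \<integral>\<^sup>+\<omega>. ennreal (\<bar>X \<omega>\<bar> ^ p) \<partial>M
      in if E = \<infinity> then \<infinity> else ennreal (enn2real E powr (1 / real p)))"

text \<open>\<open>gaussian m v\<close> has variance \<open>v\<close>, whereas \<open>normal_density\<close> takes the standard deviation.\<close>

definition gaussian :: "real \<Rightarrow> real \<Rightarrow> real measure" where
  "gaussian m v = density lborel (\<lambda>x. ennreal (normal_density m (sqrt v) x))"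

definition osc_kernel :: "real \<Rightarrow> real \<Rightarrow> real \<Rightarrow> real measure" where
  "osc_kernel A B x = gaussian (A * x) B"

definition osc_potential :: "real \<Rightarrow> real \<Rightarrow> real" where
  "osc_potential S x = exp (- S * x\<^sup>2 / 2)"

end

theory Submission
  imports Defs
begin

text \<open>
  Selection only copies walkers to positions already occupied, so once all walkers are far
  out on the same side, it leaves none closer to the origin than the innermost one was. The mutation step then
  multiplies positions by \<open>A\<close> and adds Gaussian noise; as \<open>\<bar>A\<bar> > 1\<close>, a population that is far
  enough out moves further out, geometrically fast, with a probability close to one per step.

  To make this quantitative, fix \<open>1 < a < \<bar>A\<bar>\<close> and let \<open>E n \<sigma>\<close>, for a sign \<open>\<sigma>\<close>, be the event that
  every walker at time \<open>n\<close> satisfies \<open>\<sigma> * \<xi> n i \<ge> a ^ n * R0\<close>. On \<open>E n \<sigma>\<close> the conditional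
  probability of \<open>E (Suc n) (sgn A * \<sigma>)\<close> is at least \<open>q = b ^ N\<close>, where \<open>b\<close> is the probability
  that a centred Gaussian of variance \<open>B\<close> lies in \<open>{- k .. k}\<close>, where \<open>k \<le> (\<bar>A\<bar> - a) * R0\<close>
  (\<open>dmc_walkers_step\<close>, \<open>osc_kernel_outward\<close>). So both \<open>E n 1\<close> and \<open>E n (-1)\<close> have probability at
  least \<open>q ^ n * \<pi>0\<close>, with \<open>\<pi>0 > 0\<close> because the initial Gaussian law charges every half-line.

  Having both signs at hand deals with any value \<open>c\<close> of the exact mean: the population
  can be carried off on the side opposite to \<open>c\<close>, where the empirical mean is at distance at least \<open>a ^ n * R0\<close> from \<open>c\<close> (\<open>dmc_mean_deviation\<close>). Hence the \<open>p\<close>-th moment of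
  the error is at least \<open>(a ^ n * R0) ^ p * q ^ n * \<pi>0 \<ge> (a * q) ^ n * \<pi>0\<close>. Finally, \<open>q\<close> tends to
  one as \<open>k\<close> grows, so \<open>k\<close>, and then \<open>R0\<close>, can be chosen with \<open>a * q > 1\<close>, and the moments are
  unbounded.
\<close>

section \<open>Empirical measures\<close>

lemma AE_empirical:
  fixes x :: "nat \<Rightarrow> 'a::topological_space"
  assumes "N \<ge> 1" "{y. Q y} \<in> sets borel"
  shows "(AE y in empirical N x. Q y) \<longleftrightarrow> (\<forall>i<N. Q (x i))"
proof -
  have x: "x \<in> measurable (uniform_count_measure {..<N}) borel"
    by (auto simp: measurable_def sets_uniform_count_measure space_uniform_count_measure)
  have "(AE y in empirical N x. Q y) \<longleftrightarrow> (AE i in uniform_count_measure {..<N}. Q (x i))"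
    unfolding empirical_def using assms(2) by (intro AE_distr_iff[OF x]) simp
  also have "\<dots> \<longleftrightarrow> (\<forall>i<N. Q (x i))"
    using assms(1) unfolding uniform_count_measure_def AE_point_measure by auto
  finally show ?thesis .
qed

lemma sets_empirical [simp, measurable_cong]: "sets (empirical N x) = sets borel"
  by (simp add: empirical_def)

lemma prob_space_empirical:
  assumes "N \<ge> 1"
  shows "prob_space (empirical N x)"
  unfolding empirical_def using assms
  by (intro prob_space.prob_space_distr prob_space_uniform_count_measure)
     (auto simp: measurable_def sets_uniform_count_measure space_uniform_count_measure lessThan_empty_iff)

lemma
  fixes x :: "nat \<Rightarrow> 'a::topological_space" and f :: "'a \<Rightarrow> real"
  assumes "f \<in> borel_measurable borel"
  shows integral_empirical: "(\<integral>y. f y \<partial>empirical N x) = (\<Sum>i<N. f (x i)) / real N"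
    and integrable_empirical: "integrable (empirical N x) f"
proof -
  have x: "x \<in> measurable (uniform_count_measure {..<N}) borel"
    by (auto simp: measurable_def sets_uniform_count_measure space_uniform_count_measure)
  show "(\<integral>y. f y \<partial>empirical N x) = (\<Sum>i<N. f (x i)) / real N"
    unfolding empirical_def
    by (subst integral_distr[OF x assms]) (simp add: integral_uniform_count_measure)
  show "integrable (empirical N x) f"
    unfolding empirical_def
    by (subst integrable_distr_eq[OF x assms])
       (simp add: uniform_count_measure_def integrable_point_measure_finite)
qed

text \<open>Reweighting moves mass between the walkers but leaves it on them. This is what confines the
  selection step to any set that contains all walkers.\<close>

lemma emeasure_fk_update_empirical:
  fixes x :: "nat \<Rightarrow> 'a::topological_space"
  assumes "N \<ge> 1" and G [measurable]: "G \<in> borel_measurable borel" and pos: "\<And>y. G y > 0"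
    and C [measurable]: "C \<in> sets borel" and xC: "\<And>i. i < N \<Longrightarrow> x i \<in> C"
  shows "emeasure (fk_update G (empirical N x)) C = 1"
proof -
  let ?\<eta> = "empirical N x"
  define Z where "Z = (\<integral>y. G y \<partial>?\<eta>)"
  have "(\<Sum>i<N. G (x i)) > 0"
    using assms(1) pos by (intro sum_pos) (auto simp: lessThan_empty_iff)
  then have Z: "Z > 0"
    using assms(1) by (simp add: Z_def integral_empirical[OF G])
  have C1: "AE y in ?\<eta>. y \<in> C"
    using AE_empirical[OF assms(1), of "\<lambda>y. y \<in> C"] xC by simp
  have "emeasure (fk_update G ?\<eta>) C = (\<integral>\<^sup>+y. ennreal (G y / Z) * indicator C y \<partial>?\<eta>)"
    unfolding fk_update_def Z_def[symmetric]
    by (intro emeasure_density) auto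
  also have "\<dots> = (\<integral>\<^sup>+y. ennreal (G y / Z) \<partial>?\<eta>)"
    using C1 by (intro nn_integral_cong_AE) auto
  also have "\<dots> = ennreal (\<integral>y. G y / Z \<partial>?\<eta>)"
    using Z pos by (intro nn_integral_eq_integral integrable_empirical) (auto simp: less_imp_le)
  also have "(\<integral>y. G y / Z \<partial>?\<eta>) = 1"
    using Z by (simp add: Z_def)
  finally show ?thesis by simp
qed

section \<open>Propagation of the whole population from one set to another\<close>

text \<open>If all walkers are in \<open>C\<close>, both components of the selection law, the Dirac mass and the
  reweighted empirical measure, are carried by \<open>C\<close>; so the kernel inherits any lower bound that
  \<open>P\<close> satisfies uniformly on \<open>C\<close>.\<close>

lemma dmc_kernel_lower_bound:
  fixes x :: "nat \<Rightarrow> 'a::topological_space"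
  assumes "N \<ge> 1" and G: "G \<in> borel_measurable borel" and pos: "\<And>y. G y > 0"
    and P: "P \<in> measurable borel (subprob_algebra borel)"
    and C [measurable]: "C \<in> sets borel" and D: "D \<in> sets borel"
    and c: "\<And>y. y \<in> C \<Longrightarrow> c \<le> measure (P y) D" and "c \<ge> 0"
    and xC: "\<And>i. i < N \<Longrightarrow> x i \<in> C"
    and "j < N" and e: "e * G (x j) \<in> {0..1}"
  shows "c \<le> measure (dmc_kernel G P e (empirical N x) (x j)) D"
proof -
  let ?\<eta> = "empirical N x"
  let ?S = "dmc_selection G e ?\<eta> (x j)"
  have sub: "subprob_space (P y)" "sets (P y) = sets borel" for y
    using measurable_space[OF P, of y] by (auto simp: space_subprob_algebra)
  have sb: "sets ?S = sets borel"
    unfolding dmc_selection_def using sets.sigma_sets_eq[of borel] by simp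
  have P': "P \<in> measurable ?S (subprob_algebra borel)"
    using P by (simp cong: measurable_cong_sets add: sb)
  have total: "emeasure ?S C' = 1" if "C' \<in> sets borel" "\<And>i. i < N \<Longrightarrow> x i \<in> C'" for C'
    using e that \<open>j < N\<close>
    by (simp add: emeasure_dmc_selection emeasure_fk_update_empirical[OF \<open>N \<ge> 1\<close> G pos]
        flip: ennreal_plus)
  have sp: "space ?S = UNIV"
    using sets_eq_imp_space_eq[OF sb] by simp
  have "prob_space ?S"
    using total[of UNIV] by (intro prob_spaceI) (simp add: sp)
  then interpret S: subprob_space ?S by (rule prob_space_imp_subprob_space)
  have K: "subprob_space (?S \<bind> P)"
    by (intro subprob_space_bind[OF S.subprob_space_axioms P'])
  have "ennreal c = (\<integral>\<^sup>+y. ennreal c * indicator C y \<partial>?S)"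
    using total[of C] xC by (subst nn_integral_cmult_indicator) (auto simp: sb)
  also have "\<dots> \<le> (\<integral>\<^sup>+y. emeasure (P y) D \<partial>?S)"
    using c sub by (intro nn_integral_mono)
      (auto simp: subprob_space.axioms(1) finite_measure.emeasure_eq_measure indicator_def)
  also have "\<dots> = emeasure (?S \<bind> P) D"
    using P' D by (subst emeasure_bind) (auto simp: sp)
  also have "\<dots> = ennreal (measure (?S \<bind> P) D)"
    using K by (simp add: subprob_space.axioms(1) finite_measure.emeasure_eq_measure)
  finally show ?thesis
    by (simp add: dmc_kernel_def)
qed

text \<open>By conditional independence, the probability given \<open>\<xi> n\<close> that all walkers land in \<open>D\<close> is a
  product of \<open>N\<close> factors, each at least \<open>c\<close> when all walkers start in \<open>C\<close>. Integrating over
  that event, which belongs to the conditioning algebra, gives the claim.\<close>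

lemma dmc_walkers_step:
  fixes \<xi> :: "nat \<Rightarrow> nat \<Rightarrow> 'w \<Rightarrow> 'a::topological_space"
  assumes "N \<ge> 1" and G: "G \<in> borel_measurable borel" and pos: "\<And>y. G y > 0"
    and P: "P \<in> measurable borel (subprob_algebra borel)"
    and eps: "admissible_eps G \<epsilon>" and W: "dmc_walkers M N G P \<eta>0 \<epsilon> \<xi>"
    and C [measurable]: "C \<in> sets borel" and D [measurable]: "D \<in> sets borel"
    and c: "\<And>y. y \<in> C \<Longrightarrow> c \<le> measure (P y) D" and "c \<ge> 0"
  shows "c ^ N * measure M {\<omega> \<in> space M. \<forall>i<N. \<xi> n i \<omega> \<in> C}
       \<le> measure M {\<omega> \<in> space M. \<forall>i<N. \<xi> (Suc n) i \<omega> \<in> D}"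
proof -
  interpret prob_space M using W by (simp add: dmc_walkers_def)
  have X [measurable]: "\<xi> n i \<in> borel_measurable M" if "i < N" for n i
    using W that by (simp add: dmc_walkers_def)
  define F where "F = walkers_algebra M N (\<xi> n)"
  define U where "U = {\<omega> \<in> space M. \<forall>i<N. \<xi> n i \<omega> \<in> C}"
  define V where "V = {\<omega> \<in> space M. \<forall>i<N. \<xi> (Suc n) i \<omega> \<in> D}"
  have restr: "(\<lambda>\<omega>. \<lambda>i\<in>{..<N}. \<xi> n i \<omega>) \<in> measurable M (PiM {..<N} (\<lambda>_. borel))"
    by (intro measurable_restrict X) auto
  have "subalgebra M F"
    unfolding subalgebra_def F_def walkers_algebra_def
    using sets_image_in_sets[OF refl restr] by simp
  then interpret finite_measure_subalgebra M F
    by unfold_locales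
  have UF: "U \<in> sets F"
  proof -
    have "(\<lambda>\<omega>. \<lambda>i\<in>{..<N}. \<xi> n i \<omega>) -` (PiE {..<N} (\<lambda>_. C)) \<inter> space M \<in> sets F"
      unfolding F_def walkers_algebra_def by (intro in_vimage_algebra sets_PiM_I_finite) auto
    also have "(\<lambda>\<omega>. \<lambda>i\<in>{..<N}. \<xi> n i \<omega>) -` (PiE {..<N} (\<lambda>_. C)) \<inter> space M = U"
      by (auto simp: U_def PiE_def Pi_def)
    finally show ?thesis .
  qed
  have UM: "U \<in> sets M"
    using UF subalg by (auto simp: subalgebra_def)
  have V [measurable]: "V \<in> sets M"
    unfolding V_def by measurable
  have ce: "AE \<omega> in M. real_cond_exp M F (indicator V) \<omega> =
      (\<Prod>i<N. measure (dmc_kernel G P (\<epsilon> n (empirical N (\<lambda>i. \<xi> n i \<omega>)))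
                 (empirical N (\<lambda>i. \<xi> n i \<omega>)) (\<xi> n i \<omega>)) D)"
  proof -
    have "\<forall>A. (\<forall>i<N. A i \<in> sets borel) \<longrightarrow>
        (AE \<omega> in M. real_cond_exp M (walkers_algebra M N (\<xi> n))
             (indicator {\<omega>' \<in> space M. \<forall>i<N. \<xi> (Suc n) i \<omega>' \<in> A i}) \<omega> =
           (let \<eta> = empirical N (\<lambda>i. \<xi> n i \<omega>)
            in \<Prod>i<N. measure (dmc_kernel G P (\<epsilon> n \<eta>) \<eta> (\<xi> n i \<omega>)) (A i)))"
      using W by (simp add: dmc_walkers_def)
    from this[rule_format, of "\<lambda>_. D"] show ?thesis
      by (simp add: F_def V_def Let_def)
  qed
  \<comment> \<open>The bound on the selection weight holds almost everywhere for the empirical measure, hence at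
    each of its atoms, where the kernel is evaluated.\<close>
  have adm: "\<epsilon> n (empirical N x) * G (x j) \<in> {0..1}" if "j < N" for x j
  proof -
    have "{y. \<epsilon> n (empirical N x) * G y \<in> {0..1}} \<in> sets borel"
      using G by measurable
    moreover have "AE y in empirical N x. \<epsilon> n (empirical N x) * G y \<in> {0..1}"
      using eps prob_space_empirical[OF \<open>N \<ge> 1\<close>, of x] unfolding admissible_eps_def by auto
    ultimately show ?thesis
      using AE_empirical[OF \<open>N \<ge> 1\<close>] that by blast
  qed
  have lower: "AE \<omega> in M. indicator U \<omega> * c ^ N \<le> indicator U \<omega> * real_cond_exp M F (indicator V) \<omega>"
    using ce
  proof eventually_elim
    case (elim \<omega>)
    show ?case
    proof (cases "\<omega> \<in> U")
      case True
      have "c ^ N = (\<Prod>i<N. c)" by simp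
      also have "\<dots> \<le> real_cond_exp M F (indicator V) \<omega>"
        unfolding elim using True \<open>c \<ge> 0\<close>
        by (intro prod_mono conjI dmc_kernel_lower_bound[OF \<open>N \<ge> 1\<close> G pos P C D c] adm)
           (auto simp: U_def)
      finally show ?thesis by (simp add: mult_left_mono)
    qed simp
  qed
  have intV: "integrable M (indicator V :: 'w \<Rightarrow> real)"
    using V by (intro integrable_real_indicator) (auto simp: emeasure_eq_measure)
  have "c ^ N * measure M U = (\<integral>\<omega>. indicator U \<omega> * c ^ N \<partial>M)"
    using UM by simp
  also have "\<dots> \<le> (\<integral>\<omega>. indicator U \<omega> * real_cond_exp M F (indicator V) \<omega> \<partial>M)"
    using lower UM real_cond_exp_int(1)[OF intV]
    by (intro integral_mono_AE integrable_real_mult_indicator integrable_mult_indicator[where 'b=real, simplified]) auto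
  also have "\<dots> = (\<integral>\<omega>. indicator U \<omega> * indicator V \<omega> \<partial>M)"
    using real_cond_exp_intA[OF intV UF] by (simp add: set_lebesgue_integral_def)
  also have "\<dots> = measure M (U \<inter> V)"
    using UM by (simp add: indicator_inter_arith[symmetric])
  also have "\<dots> \<le> measure M V"
    by (intro finite_measure_mono) auto
  finally show ?thesis unfolding U_def V_def .
qed

section \<open>Gaussian estimates\<close>

lemma sets_gaussian [simp, measurable_cong]: "sets (gaussian m v) = sets borel"
  by (simp add: gaussian_def)

lemma space_gaussian [simp]: "space (gaussian m v) = UNIV"
  by (simp add: gaussian_def)

lemma prob_space_gaussian: "v > 0 \<Longrightarrow> prob_space (gaussian m v)"
  unfolding gaussian_def by (intro prob_space_normal_density) simp

text \<open>Expressing all Gaussians of a given variance through a single centred one gives both the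
  measurability of the oscillator kernel and bounds that are uniform in the starting point.\<close>

lemma gaussian_translate:
  assumes "v > 0"
  shows "gaussian m v = distr (gaussian 0 v) borel (\<lambda>z. m + z)"
proof -
  have "distr (gaussian 0 v) lborel (\<lambda>z. m + z) = gaussian m v"
  proof -
    interpret prob_space "gaussian 0 v" using assms by (rule prob_space_gaussian)
    have "distributed (gaussian 0 v) lborel (\<lambda>x. x) (normal_density 0 (sqrt v))"
      unfolding distributed_def gaussian_def
      by (auto simp: distr_id2)
    from normal_density_affine[OF this, of 1 m] assms
    show ?thesis
      by (simp add: distributed_def gaussian_def)
  qed
  then show ?thesis by (simp cong: distr_cong)
qed

lemma measurable_osc_kernel:
  assumes "B > 0"
  shows "osc_kernel A B \<in> measurable borel (subprob_algebra borel)"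
proof -
  have "gaussian 0 B \<in> space (subprob_algebra borel)"
    using prob_space_gaussian[OF assms, of 0]
    by (simp add: space_subprob_algebra prob_space_imp_subprob_space)
  then have "(\<lambda>x. distr (gaussian 0 B) borel (\<lambda>z. A * x + z)) \<in> measurable borel (subprob_algebra borel)"
    by (intro measurable_distr2[where M = borel]) (auto intro: measurable_const)
  also have "(\<lambda>x. distr (gaussian 0 B) borel (\<lambda>z. A * x + z)) = osc_kernel A B"
    unfolding osc_kernel_def by (intro ext gaussian_translate[OF assms, symmetric])
  finally show ?thesis .
qed

text \<open>A set of measure zero for a density that is positive everywhere is a Lebesgue null set,
  whereas a half-line contains an interval of length one.\<close>

lemma gaussian_halfline_pos:
  fixes s :: real
  assumes "v > 0" "s \<noteq> 0"
  shows "measure (gaussian m v) {y. s * y \<ge> r} > 0"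
proof -
  interpret prob_space "gaussian m v" using assms(1) by (rule prob_space_gaussian)
  let ?H = "{y. s * y \<ge> r}"
  have "emeasure (gaussian m v) ?H \<noteq> 0"
  proof
    assume "emeasure (gaussian m v) ?H = 0"
    then have "AE x in lborel. x \<notin> ?H"
      using assms(1) normal_density_pos[of "sqrt v" m]
      unfolding gaussian_def
      by (auto simp: emeasure_density nn_integral_0_iff_AE indicator_def less_le elim!: eventually_mono split: if_splits)
    then have "emeasure lborel ?H = 0"
      by (subst (asm) AE_iff_measurable[of ?H]) auto
    \<comment> \<open>The half-line lies to the right or to the left of \<open>r/s\<close>, according to the sign of \<open>s\<close>.\<close>
    moreover have "{r/s .. r/s + 1} \<subseteq> ?H \<or> {r/s - 1 .. r/s} \<subseteq> ?H"
      using assms(2) by (cases "s > 0") (auto simp: field_simps)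
    then have "emeasure lborel ?H \<ge> 1"
      using emeasure_mono[of "{r/s .. r/s + 1}" ?H lborel] emeasure_mono[of "{r/s - 1 .. r/s}" ?H lborel]
      by auto
    ultimately show False by simp
  qed
  then show ?thesis
    by (simp add: emeasure_eq_measure zero_less_measure_iff)
qed

lemma prob_interval_tendsto_1:
  fixes \<mu> :: "real measure"
  assumes "prob_space \<mu>" and [simp]: "sets \<mu> = sets borel"
  shows "(\<lambda>n. measure \<mu> {- real n .. real n}) \<longlonglongrightarrow> 1"
proof -
  interpret prob_space \<mu> by fact
  have "(\<lambda>n. measure \<mu> {- real n .. real n}) \<longlonglongrightarrow> measure \<mu> (\<Union>n. {- real n .. real n})"
    by (intro finite_Lim_measure_incseq) (auto simp: incseq_def)
  also have "(\<Union>n. {- real n .. real n}) = space \<mu>"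
  proof -
    have "\<exists>n. - real n \<le> x \<and> x \<le> real n" for x
      using real_arch_simple[of "\<bar>x\<bar>"] by (metis abs_le_iff minus_le_iff)
    then show ?thesis using sets_eq_imp_space_eq[OF assms(2)] by auto
  qed
  finally show ?thesis by (simp add: prob_space)
qed

text \<open>From a point at distance at least \<open>r\<close> out on side \<open>\<sigma>\<close>, the drift leads to distance at least
  \<open>\<bar>A\<bar> * r\<close> on side \<open>sgn A * \<sigma>\<close>. This leaves a margin \<open>(\<bar>A\<bar> - a) * r\<close> for the noise. As the
  margin grows with \<open>r\<close>, one and the same \<open>t\<close> serves at all later, larger distances.\<close>

lemma osc_kernel_outward:
  fixes \<sigma> :: real
  assumes "B > 0" "\<bar>\<sigma>\<bar> = 1" "a \<ge> 0" "t \<le> (\<bar>A\<bar> - a) * r" "\<sigma> * y \<ge> r"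
  shows "measure (gaussian 0 B) {-t..t} \<le> measure (osc_kernel A B y) {z. sgn A * \<sigma> * z \<ge> a * r}"
proof -
  interpret prob_space "gaussian 0 B" using assms(1) by (rule prob_space_gaussian)
  have "a * r \<le> sgn A * \<sigma> * (A * y + z)" if "z \<in> {-t..t}" for z
  proof -
    have "sgn A * \<sigma> * z \<ge> - \<bar>z\<bar>"
    proof -
      have "\<bar>sgn A * \<sigma> * z\<bar> \<le> \<bar>z\<bar>" using assms(2) by (simp add: abs_mult abs_sgn_eq)
      then show ?thesis by linarith
    qed
    moreover have "\<bar>z\<bar> \<le> t" using that by auto
    moreover have "\<bar>A\<bar> * (\<sigma> * y) \<ge> \<bar>A\<bar> * r" using assms(5) by (intro mult_left_mono) auto
    moreover have "sgn A * \<sigma> * (A * y + z) = \<bar>A\<bar> * (\<sigma> * y) + sgn A * \<sigma> * z"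
      using abs_sgn[of A] by (metis (no_types, opaque_lifting) distrib_left mult.assoc mult.commute)
    ultimately show ?thesis using assms(4) by (simp only: left_diff_distrib)
  qed
  then have "measure (gaussian 0 B) {-t..t} \<le>
      measure (gaussian 0 B) ((\<lambda>z. A * y + z) -` {z. sgn A * \<sigma> * z \<ge> a * r} \<inter> space (gaussian 0 B))"
    by (intro finite_measure_mono) auto
  also have "\<dots> = measure (osc_kernel A B y) {z. sgn A * \<sigma> * z \<ge> a * r}"
    unfolding osc_kernel_def gaussian_translate[OF assms(1), of "A * y"]
    by (subst measure_distr) auto
  finally show ?thesis .
qed

section \<open>Divergence of the error\<close>

lemma Lp_norm_geI:
  assumes "p \<ge> 1" "K \<ge> 0" "ennreal (K ^ p) \<le> (\<integral>\<^sup>+\<omega>. ennreal (\<bar>X \<omega>\<bar> ^ p) \<partial>M)"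
  shows "ennreal K \<le> Lp_norm M p X"
proof (cases "(\<integral>\<^sup>+\<omega>. ennreal (\<bar>X \<omega>\<bar> ^ p) \<partial>M) = \<infinity>")
  case False
  then obtain E where E: "(\<integral>\<^sup>+\<omega>. ennreal (\<bar>X \<omega>\<bar> ^ p) \<partial>M) = ennreal E" "E \<ge> 0"
    by (metis ennreal_cases infinity_ennreal_def)
  have "K = (K ^ p) powr (1 / real p)"
    using assms(1,2) by (cases "K = 0") (auto simp: powr_powr simp flip: powr_realpow)
  also have "\<dots> \<le> E powr (1 / real p)"
    using assms E by (intro powr_mono2) auto
  finally show ?thesis
    using E by (simp add: Lp_norm_def ennreal_leI)
qed (simp add: Lp_norm_def)

text \<open>The mean of walkers that are all beyond \<open>R\<close> on one side is beyond \<open>R\<close> on that side, so it is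
  enough to use the side of the origin on which \<open>c\<close> does not lie.\<close>

lemma dmc_mean_deviation:
  fixes \<xi> :: "nat \<Rightarrow> nat \<Rightarrow> 'w \<Rightarrow> real" and c :: real
  assumes "prob_space M" "N \<ge> 1" "R \<ge> 0"
    and X: "\<And>i. i < N \<Longrightarrow> \<xi> n i \<in> borel_measurable M"
    and prob: "\<And>\<sigma>::real. \<bar>\<sigma>\<bar> = 1 \<Longrightarrow>
      \<pi> \<le> measure M {\<omega> \<in> space M. \<forall>i<N. \<sigma> * \<xi> n i \<omega> \<ge> R}"
  shows "ennreal (R ^ p * \<pi>) \<le>
    (\<integral>\<^sup>+\<omega>. ennreal (\<bar>c - (\<integral>x. x \<partial>empirical N (\<lambda>i. \<xi> n i \<omega>))\<bar> ^ p) \<partial>M)"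
proof -
  interpret prob_space M by fact
  note X [measurable]
  define \<sigma> :: real where "\<sigma> = (if c > 0 then -1 else 1)"
  have \<sigma>: "\<bar>\<sigma>\<bar> = 1" "\<sigma> * c \<le> 0" by (auto simp: \<sigma>_def)
  define D where "D = {\<omega> \<in> space M. \<forall>i<N. \<sigma> * \<xi> n i \<omega> \<ge> R}"
  have D: "D \<in> sets M" unfolding D_def by measurable
  have dev: "R \<le> \<bar>c - (\<integral>x. x \<partial>empirical N (\<lambda>i. \<xi> n i \<omega>))\<bar>" if "\<omega> \<in> D" for \<omega>
  proof -
    let ?m = "(\<Sum>i<N. \<xi> n i \<omega>) / real N"
    have "real N * R = (\<Sum>i<N. R)" by simp
    also have "\<dots> \<le> (\<Sum>i<N. \<sigma> * \<xi> n i \<omega>)"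
      using that by (intro sum_mono) (auto simp: D_def)
    also have "\<dots> = real N * (\<sigma> * ?m)"
      using \<open>N \<ge> 1\<close> by (simp flip: sum_distrib_left)
    finally have "R \<le> \<sigma> * ?m" using \<open>N \<ge> 1\<close> by (simp add: field_simps)
    also have "\<dots> \<le> \<sigma> * (?m - c)" using \<sigma> by (simp add: algebra_simps)
    also have "\<dots> \<le> \<bar>c - ?m\<bar>" using \<sigma>(1) by (auto simp: \<sigma>_def)
    finally show ?thesis by (simp add: integral_empirical)
  qed
  have "ennreal (R ^ p * \<pi>) \<le> ennreal (R ^ p * measure M D)"
    using prob[OF \<sigma>(1)] \<open>R \<ge> 0\<close> unfolding D_def by (intro ennreal_leI mult_left_mono) auto
  also have "\<dots> = (\<integral>\<^sup>+\<omega>. ennreal (R ^ p) * indicator D \<omega> \<partial>M)"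
    using D \<open>R \<ge> 0\<close> by (simp add: nn_integral_cmult_indicator emeasure_eq_measure ennreal_mult)
  also have "\<dots> \<le> (\<integral>\<^sup>+\<omega>. ennreal (\<bar>c - (\<integral>x. x \<partial>empirical N (\<lambda>i. \<xi> n i \<omega>))\<bar> ^ p) \<partial>M)"
    using dev \<open>R \<ge> 0\<close>
    by (intro nn_integral_mono) (auto simp: indicator_def intro!: ennreal_leI power_mono)
  finally show ?thesis .
qed

theorem proposition1:
  fixes A B S m0 \<sigma>0 :: real
    and \<epsilon> :: "nat \<Rightarrow> real measure \<Rightarrow> real"
    and M :: "'w measure"
    and \<xi> :: "nat \<Rightarrow> nat \<Rightarrow> 'w \<Rightarrow> real"
    and p N :: nat
  assumes "B > 0" and "S > 0" and "\<sigma>0\<^sup>2 > 0"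
    and "A\<^sup>2 > 1"
    and "p \<ge> 1" and "N \<ge> 1"
    and "admissible_eps (osc_potential S) \<epsilon>"
    and "dmc_walkers M N (osc_potential S) (osc_kernel A B) (gaussian m0 (\<sigma>0\<^sup>2)) \<epsilon> \<xi>"
  shows "(SUP n. Lp_norm M p (\<lambda>\<omega>.
            (\<integral>x. x \<partial>(fk_flow (osc_potential S) (osc_kernel A B) (gaussian m0 (\<sigma>0\<^sup>2)) n))
          - (\<integral>x. x \<partial>(empirical N (\<lambda>i. \<xi> n i \<omega>))))) = \<infinity>"
proof -
  note W = assms(8)
  interpret prob_space M using W by (simp add: dmc_walkers_def)
  have X [measurable]: "\<xi> n i \<in> borel_measurable M" if "i < N" for n i
    using W that by (simp add: dmc_walkers_def)
  have G: "osc_potential S \<in> borel_measurable borel" "osc_potential S y > 0" for y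
    by (auto simp: osc_potential_def[abs_def])
  have A: "\<bar>A\<bar> > 1"
    using assms(4) by (simp add: abs_square_less_1 flip: not_le abs_square_le_1)
  define a where "a = (1 + \<bar>A\<bar>) / 2"
  have a: "1 < a" "a < \<bar>A\<bar>" using A by (auto simp: a_def)
  have "(\<lambda>k. a * measure (gaussian 0 B) {- real k .. real k} ^ N) \<longlonglongrightarrow> a * 1 ^ N"
    using assms(1) by (intro tendsto_intros prob_interval_tendsto_1 prob_space_gaussian) auto
  then have "eventually (\<lambda>k. a * measure (gaussian 0 B) {- real k .. real k} ^ N > 1) sequentially"
    using a by (intro order_tendstoD(1)) auto
  then obtain k where k: "a * measure (gaussian 0 B) {- real k .. real k} ^ N > 1"
    by (auto simp: eventually_sequentially)
  define b where "b = measure (gaussian 0 B) {- real k .. real k}"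
  \<comment> \<open>\<open>R0\<close> gives the noise a margin of at least \<open>k\<close> at time zero; \<open>R0 \<ge> 1\<close> allows the exponent
    \<open>p\<close> to be dropped from \<open>(a ^ n * R0) ^ p\<close> later.\<close>
  define R0 where "R0 = max 1 (real k / (\<bar>A\<bar> - a))"
  have R0: "R0 \<ge> 1" "real k \<le> (\<bar>A\<bar> - a) * R0"
    using a by (auto simp: R0_def max_def field_simps)
  define E where "E n \<sigma> = {\<omega> \<in> space M. \<forall>i<N. \<sigma> * \<xi> n i \<omega> \<ge> a ^ n * R0}" for n and \<sigma> :: real
  have step: "b ^ N * measure M (E n \<sigma>) \<le> measure M (E (Suc n) (sgn A * \<sigma>))"
    if "\<bar>\<sigma>\<bar> = 1" for n \<sigma>
  proof -
    have "real k \<le> (\<bar>A\<bar> - a) * (a ^ n * R0)"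
    proof -
      have "R0 \<le> a ^ n * R0" using a R0 by (simp add: one_le_power)
      then have "(\<bar>A\<bar> - a) * R0 \<le> (\<bar>A\<bar> - a) * (a ^ n * R0)"
        using a by (intro mult_left_mono) auto
      then show ?thesis using R0(2) by linarith
    qed
    then have "b \<le> measure (osc_kernel A B y) {z. sgn A * \<sigma> * z \<ge> a * (a ^ n * R0)}"
      if "\<sigma> * y \<ge> a ^ n * R0" for y
      unfolding b_def using that \<open>\<bar>\<sigma>\<bar> = 1\<close> a assms(1) by (intro osc_kernel_outward) auto
    then show ?thesis
      using dmc_walkers_step[OF \<open>N \<ge> 1\<close> G measurable_osc_kernel[OF assms(1)] assms(7,8),
          of "{y. \<sigma> * y \<ge> a ^ n * R0}" "{z. sgn A * \<sigma> * z \<ge> a * (a ^ n * R0)}" b n]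
      by (simp add: E_def b_def mult.assoc)
  qed
  have init: "measure M (E 0 \<sigma>) = measure (gaussian m0 (\<sigma>0\<^sup>2)) {y. \<sigma> * y \<ge> R0} ^ N" for \<sigma>
  proof -
    let ?H = "{y. \<sigma> * y \<ge> R0}"
    have "measure M (\<xi> 0 i -` ?H \<inter> space M) = measure (gaussian m0 (\<sigma>0\<^sup>2)) ?H" if "i < N" for i
    proof -
      have "distr M borel (\<xi> 0 i) = gaussian m0 (\<sigma>0\<^sup>2)"
        using W that by (simp add: dmc_walkers_def)
      then show ?thesis using X[OF that] measure_distr[of "\<xi> 0 i" M borel ?H] by simp
    qed
    moreover have "indep_vars (\<lambda>_. borel) (\<xi> 0) {..<N}"
      using W by (simp add: dmc_walkers_def)
    then have "prob (\<Inter>i\<in>{..<N}. \<xi> 0 i -` ?H \<inter> space M) = (\<Prod>i\<in>{..<N}. prob (\<xi> 0 i -` ?H \<inter> space M))"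
      using \<open>N \<ge> 1\<close> by (intro indep_varsD_finite) (auto simp: lessThan_empty_iff)
    moreover have "(\<Inter>i\<in>{..<N}. \<xi> 0 i -` ?H \<inter> space M) = E 0 \<sigma>"
      using \<open>N \<ge> 1\<close> by (auto simp: E_def lessThan_empty_iff)
    ultimately show ?thesis by simp
  qed
  define \<pi>0 where "\<pi>0 = min (measure M (E 0 1)) (measure M (E 0 (-1)))"
  have \<pi>0: "\<pi>0 > 0"
    using gaussian_halfline_pos[OF assms(3), of 1 m0 R0] gaussian_halfline_pos[OF assms(3), of "-1" m0 R0]
    by (auto simp: \<pi>0_def init)
  have prob: "(b ^ N) ^ n * \<pi>0 \<le> measure M (E n \<sigma>)" if "\<bar>\<sigma>\<bar> = 1" for n \<sigma>
    using that
  proof (induction n arbitrary: \<sigma>)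
    case 0
    then show ?case by (auto simp: \<pi>0_def abs_if split: if_splits)
  next
    case (Suc n)
    \<comment> \<open>A population on side \<open>\<sigma>\<close> at time \<open>Suc n\<close> is reached from side \<open>sgn A * \<sigma>\<close> at time \<open>n\<close>.\<close>
    have s: "\<bar>sgn A * \<sigma>\<bar> = 1" "sgn A * (sgn A * \<sigma>) = \<sigma>"
      using Suc.prems A by (auto simp: abs_mult abs_sgn_eq sgn_if)
    have "(b ^ N) ^ Suc n * \<pi>0 = b ^ N * ((b ^ N) ^ n * \<pi>0)" by simp
    also have "\<dots> \<le> b ^ N * measure M (E n (sgn A * \<sigma>))"
      using Suc.IH[OF s(1)] by (intro mult_left_mono) (auto simp: b_def)
    also have "\<dots> \<le> measure M (E (Suc n) \<sigma>)"
      using step[OF s(1)] unfolding s(2) .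
    finally show ?case .
  qed
  have large: "\<exists>n. K \<le> (a ^ n * R0) ^ p * ((b ^ N) ^ n * \<pi>0)" for K
  proof -
    obtain n where n: "K / \<pi>0 < (a * b ^ N) ^ n"
      using real_arch_pow[OF k] unfolding b_def by blast
    have "K \<le> (a * b ^ N) ^ n * \<pi>0"
      using n \<pi>0 by (simp add: field_simps)
    also have "\<dots> = a ^ n * ((b ^ N) ^ n * \<pi>0)" by (simp add: power_mult_distrib)
    also have "\<dots> \<le> (a ^ n * R0) ^ p * ((b ^ N) ^ n * \<pi>0)"
    proof (rule mult_right_mono)
      have "a ^ n \<le> a ^ n * R0" using R0 a by simp
      also have "\<dots> \<le> (a ^ n * R0) ^ p"
        using a R0 \<open>p \<ge> 1\<close> by (intro self_le_power) (auto intro: order_trans[OF _ \<open>a ^ n \<le> a ^ n * R0\<close>] one_le_power)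
      finally show "a ^ n \<le> (a ^ n * R0) ^ p" .
      show "0 \<le> (b ^ N) ^ n * \<pi>0" using \<pi>0 by (simp add: b_def)
    qed
    finally show ?thesis by blast
  qed
  let ?L = "\<lambda>n. Lp_norm M p (\<lambda>\<omega>.
            (\<integral>x. x \<partial>(fk_flow (osc_potential S) (osc_kernel A B) (gaussian m0 (\<sigma>0\<^sup>2)) n))
          - (\<integral>x. x \<partial>(empirical N (\<lambda>i. \<xi> n i \<omega>))))"
  have bound: "ennreal K \<le> (SUP n. ?L n)" if "K \<ge> 0" for K
  proof -
    obtain n where n: "K ^ p \<le> (a ^ n * R0) ^ p * ((b ^ N) ^ n * \<pi>0)"
      using large by blast
    have "ennreal K \<le> ?L n"
      using \<open>p \<ge> 1\<close> \<open>K \<ge> 0\<close>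
    proof (rule Lp_norm_geI, intro order_trans[OF ennreal_leI[OF n]] dmc_mean_deviation)
      show "(b ^ N) ^ n * \<pi>0 \<le> measure M {\<omega> \<in> space M. \<forall>i<N. \<sigma> * \<xi> n i \<omega> \<ge> a ^ n * R0}"
        if "\<bar>\<sigma>\<bar> = 1" for \<sigma> :: real
        using prob[OF that] by (simp add: E_def)
    qed (use a R0 X \<open>N \<ge> 1\<close> prob_space_axioms in auto)
    then show ?thesis by (rule SUP_upper2[OF UNIV_I])
  qed
  show ?thesis
  proof (cases "SUP n. ?L n" rule: ennreal_cases)
    case (real r)
    have "ennreal (r + 1) \<le> (SUP n. ?L n)"
      using real(1) by (intro bound) simp
    also have "\<dots> = ennreal r" by (fact real(2))
    finally show ?thesis using real(1) by (simp only: ennreal_le_iff)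
  qed (simp only: infinity_ennreal_def)
qed

end
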